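(* Let $D$ be an integral domain with quotient field $K$ and let $\{S_i\}_i$ be a family of multiplicative subsets of $D$ (not containing $0$) such that $D=\bigcap_i S_i^{-1}D$. Then $\mathrm{Int}^{\mathrm R}(D)=\bigcap_i S_i^{-1}\mathrm{Int}^{\mathrm R}(D)$.
   Context: For an integral domain $D$ with quotient field $K$, $\mathrm{Int}^{\mathrm R}(D):=\{f\in K(X);\ f(D)\subseteq D\}$, where $f(D)\subseteq D$ means that for every $d\in D$ the rational function $f$ is defined at $d$ and $f(d)\in D$. Localizations $S_i^{-1}D$ are regarded as subrings of $K$, and $S_i^{-1}\mathrm{Int}^{\mathrm R}(D)$ as subrings of $K(X)$. *)

theory Defs
  imports "HOL-Computational_Algebra.Polynomial_Factorial"
begin

(* Throughout, D is the type 'a :: idom, K = 'a fract with D embedded by to_fract,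
   and K(X) = 'a fract poly fract. *)

definition multiplicative_subset :: "'a::comm_monoid_mult set \<Rightarrow> bool" where
  "multiplicative_subset S \<longleftrightarrow> 1 \<in> S \<and> (\<forall>s\<in>S. \<forall>t\<in>S. s * t \<in> S)"

(* S^{-1}A inside an ambient field; only meaningful when 0 is not in S, since x / 0 = 0. *)
definition localization :: "'f::field set \<Rightarrow> 'f set \<Rightarrow> 'f set" where
  "localization S A = {a / s | a s. a \<in> A \<and> s \<in> S}"

definition ratfun_const :: "'k::field \<Rightarrow> 'k poly fract" where
  "ratfun_const c = to_fract [:c:]"

(* Some fraction representing f has denominator not vanishing at x. In particular that
   denominator is a nonzero polynomial, so the junk value Fract p 0 = 0 plays no role. *)
definition ratfun_defined_at :: "'k::field poly fract \<Rightarrow> 'k \<Rightarrow> bool" where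
  "ratfun_defined_at f x \<longleftrightarrow> (\<exists>p q. f = Fraction_Field.Fract p q \<and> poly q x \<noteq> 0)"

definition ratfun_eval :: "'k::field poly fract \<Rightarrow> 'k \<Rightarrow> 'k" where
  "ratfun_eval f x =
     (THE y. \<exists>p q. f = Fraction_Field.Fract p q \<and> poly q x \<noteq> 0 \<and> y = poly p x / poly q x)"

lemma ratfun_eval_Fract:
  fixes p q :: "'k::field poly"
  assumes "poly q x \<noteq> 0"
  shows "ratfun_eval (Fraction_Field.Fract p q) x = poly p x / poly q x"
  unfolding ratfun_eval_def
proof (rule the_equality)
  show "\<exists>p' q'. Fraction_Field.Fract p q = Fraction_Field.Fract p' q' \<and> poly q' x \<noteq> 0
          \<and> poly p x / poly q x = poly p' x / poly q' x"
    using assms by blast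
next
  fix y
  assume "\<exists>p' q'. Fraction_Field.Fract p q = Fraction_Field.Fract p' q' \<and> poly q' x \<noteq> 0
            \<and> y = poly p' x / poly q' x"
  then obtain p' q' where *: "Fraction_Field.Fract p q = Fraction_Field.Fract p' q'"
      "poly q' x \<noteq> 0" "y = poly p' x / poly q' x"
    by blast
  have "q \<noteq> 0" "q' \<noteq> 0"
    using assms *(2) by auto
  with *(1) have "p * q' = p' * q"
    by (simp add: eq_fract)
  hence "poly p x * poly q' x = poly p' x * poly q x"
    by (metis poly_mult)
  with assms *(2,3) show "y = poly p x / poly q x"
    by (simp add: frac_eq_eq)
qed

definition int_rat :: "'a::idom fract poly fract set" where
  "int_rat = {f. \<forall>d::'a. ratfun_defined_at f (to_fract d)
                        \<and> ratfun_eval f (to_fract d) \<in> range (to_fract :: 'a \<Rightarrow> 'a fract)}"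

end

theory Submission
  imports Defs
begin

text \<open>
  Evaluation at a point is compatible with division by a nonzero constant. So if \<open>f = g / s\<close> with
  \<open>g\<close> integer-valued and \<open>s\<close> a nonzero constant of the multiplicative set, then for each \<open>d\<close> in the
  domain \<open>f\<close> is defined at \<open>d\<close> and \<open>f(d) = g(d) / s\<close> lies in the corresponding localization of the
  domain. If this holds for every member of the family, then \<open>f(d)\<close> lies in the intersection of
  the localizations, which is the domain itself. The other inclusion only needs \<open>f = f / 1\<close>.
\<close>

lemma divide_ratfun_const_Fract:
  fixes c :: "'k::field"
  shows "Fraction_Field.Fract p q / ratfun_const c = Fraction_Field.Fract p (smult c q)"
  by (simp add: ratfun_const_def to_fract_def)

lemma ratfun_const_1 [simp]: "ratfun_const 1 = 1"
  by (simp add: ratfun_const_def flip: one_pCons)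

lemma ratfun_defined_at_divide_const:
  assumes "ratfun_defined_at g x" and "c \<noteq> 0"
  shows "ratfun_defined_at (g / ratfun_const c) x"
proof -
  obtain p q where "g = Fraction_Field.Fract p q" "poly q x \<noteq> 0"
    using assms(1) by (auto simp: ratfun_defined_at_def)
  then have "g / ratfun_const c = Fraction_Field.Fract p (smult c q)" "poly (smult c q) x \<noteq> 0"
    using assms(2) by (simp_all add: divide_ratfun_const_Fract)
  then show ?thesis
    unfolding ratfun_defined_at_def by blast
qed

lemma ratfun_eval_divide_const:
  assumes "ratfun_defined_at g x" and "c \<noteq> 0"
  shows "ratfun_eval (g / ratfun_const c) x = ratfun_eval g x / c"
proof -
  obtain p q where "g = Fraction_Field.Fract p q" "poly q x \<noteq> 0"
    using assms(1) by (auto simp: ratfun_defined_at_def)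
  then show ?thesis
    using assms(2) by (simp add: divide_ratfun_const_Fract ratfun_eval_Fract mult.commute)
qed

text \<open>
  Values on the domain of elements of a localized ring of integer-valued rational functions lie
  in the localized domain.
\<close>
lemma localization_int_rat_eval:
  fixes S :: "'a::idom set" and d :: 'a
  assumes "f \<in> localization ((\<lambda>s. ratfun_const (to_fract s)) ` S) int_rat" and "0 \<notin> S"
  shows "ratfun_defined_at f (to_fract d)"
    and "ratfun_eval f (to_fract d) \<in> localization (to_fract ` S) (range to_fract)"
proof -
  obtain g s where g: "g \<in> int_rat" and s: "s \<in> S" and f: "f = g / ratfun_const (to_fract s)"
    using assms(1) by (auto simp: localization_def)
  have s0: "to_fract s \<noteq> 0"
    using s assms(2) by auto
  have gd: "ratfun_defined_at g (to_fract d)" "ratfun_eval g (to_fract d) \<in> range to_fract"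
    using g by (auto simp: int_rat_def)
  show "ratfun_defined_at f (to_fract d)"
    unfolding f using gd(1) s0 by (rule ratfun_defined_at_divide_const)
  show "ratfun_eval f (to_fract d) \<in> localization (to_fract ` S) (range to_fract)"
    unfolding f ratfun_eval_divide_const[OF gd(1) s0] localization_def
    using gd(2) s by blast
qed

lemma subset_localization:
  assumes "1 \<in> S"
  shows "A \<subseteq> localization S A"
proof
  fix a assume "a \<in> A"
  moreover have "a = a / 1" by simp
  ultimately show "a \<in> localization S A"
    unfolding localization_def using assms by blast
qed

theorem theorem2p7:
  fixes S :: "'i \<Rightarrow> 'a::idom set" and I :: "'i set"
  assumes "I \<noteq> {}"
    and "\<And>i. i \<in> I \<Longrightarrow> multiplicative_subset (S i)"
    and "\<And>i. i \<in> I \<Longrightarrow> 0 \<notin> S i"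
    and "range (to_fract :: 'a \<Rightarrow> 'a fract) =
           (\<Inter>i\<in>I. localization (to_fract ` S i) (range to_fract))"
  shows "(int_rat :: 'a fract poly fract set) =
           (\<Inter>i\<in>I. localization ((\<lambda>s. ratfun_const (to_fract s)) ` S i) int_rat)"
proof (intro equalityI INT_greatest)
  fix i assume "i \<in> I"
  then have "1 \<in> S i"
    using assms(2) by (auto simp: multiplicative_subset_def)
  then have "1 \<in> (\<lambda>s. ratfun_const (to_fract s)) ` S i"
    by (rule rev_image_eqI) simp
  then show "int_rat \<subseteq> localization ((\<lambda>s. ratfun_const (to_fract s)) ` S i) int_rat"
    by (rule subset_localization)
next
  show "(\<Inter>i\<in>I. localization ((\<lambda>s. ratfun_const (to_fract s)) ` S i) int_rat) \<subseteq> int_rat"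
  proof
    fix f
    assume "f \<in> (\<Inter>i\<in>I. localization ((\<lambda>s. ratfun_const (to_fract s)) ` S i) int_rat)"
    then have f: "f \<in> localization ((\<lambda>s. ratfun_const (to_fract s)) ` S i) int_rat" if "i \<in> I" for i
      using that by blast
    have "ratfun_defined_at f (to_fract d) \<and> ratfun_eval f (to_fract d) \<in> range to_fract" for d :: 'a
    proof
      \<comment> \<open>For the empty family the intersection would be all of \<open>K(X)\<close>, poles included.\<close>
      show "ratfun_defined_at f (to_fract d)"
        using assms(1,3) f localization_int_rat_eval(1) by blast
      show "ratfun_eval f (to_fract d) \<in> range to_fract"
        by (subst assms(4)) (use assms(3) f localization_int_rat_eval(2) in blast)
    qed
    then show "f \<in> int_rat"
      by (simp add: int_rat_def)
  qed
qed

end
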